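(* Let $\mathfrak{g}$ be a Lie algebra, let $M$ be a left $\mathfrak{g}$-module considered as a symmetric Leibniz $\mathfrak{g}$-bimodule $M_s$, and let $n$ be a non-negative integer. If $\mathrm{H}^k(\mathfrak{g},M)=0$ for every integer $k$ with $0\le k\le n$, then $\mathrm{HL}^k(\mathfrak{g},M_s)=0$ for every integer $k$ with $0\le k\le n$, and $\mathrm{HL}^{n+1}(\mathfrak{g},M_s)\cong\mathrm{H}^{n+1}(\mathfrak{g},M)$ as well as $\mathrm{HL}^{n+2}(\mathfrak{g},M_s)\cong\mathrm{H}^{n+2}(\mathfrak{g},M)$. In particular, $\mathrm{H}^\bullet(\mathfrak{g},M)=0$ implies $\mathrm{HL}^\bullet(\mathfrak{g},M_s)=0$.
   Context: $\mathrm{H}^\bullet(\mathfrak{g},M)$ denotes Chevalley–Eilenberg cohomology. A Lie algebra is regarded as a left Leibniz algebra with product $xy=[x,y]$; $M_s$ is $M$ with the given left action and right action $m\cdot x:=-x\cdot m$. $\mathrm{HL}^n(\mathfrak{g},M_s)$ is the cohomology of $\mathrm{CL}^n(\mathfrak{g},M_s)=\mathrm{Hom}(\mathfrak{g}^{\otimes n},M)$ with $(\mathrm{d}^nf)(x_1,\dots,x_{n+1})=\sum_{i=1}^n(-1)^{i+1}x_i\cdot f(\dots,\hat{x}_i,\dots)+(-1)^{n+1}f(x_1,\dots,x_n)\cdot x_{n+1}+\sum_{i<j}(-1)^if(x_1,\dots,\hat{x}_i,\dots,x_ix_j,\dots,x_{n+1})$ ($x_ix_j$ in the $j$-th position). 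*)

theory Defs
  imports Main HOL.Vector_Spaces
begin

text \<open>Scalars: a field 'k. The Lie algebra is a 'k-vector space 'g (scalar multiplication sg)
with bracket br; the module M is a 'k-vector space 'm (scalar multiplication sm) with left action act.
Cochains are functions on lists of elements of 'g; a degree-n cochain vanishes on lists of
length different from n and is multilinear in its n arguments.\<close>

definition lie_algebra ::
  "('k::field \<Rightarrow> 'g::ab_group_add \<Rightarrow> 'g) \<Rightarrow> ('g \<Rightarrow> 'g \<Rightarrow> 'g) \<Rightarrow> bool" where
  "lie_algebra sg br \<longleftrightarrow>
     vector_space sg \<and>
     (\<forall>a b x y z. br (sg a x + sg b y) z = sg a (br x z) + sg b (br y z)) \<and>
     (\<forall>a b x y z. br z (sg a x + sg b y) = sg a (br z x) + sg b (br z y)) \<and>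
     (\<forall>x. br x x = 0) \<and>
     (\<forall>x y z. br x (br y z) + br y (br z x) + br z (br x y) = 0)"

definition lie_module ::
  "('k::field \<Rightarrow> 'g::ab_group_add \<Rightarrow> 'g) \<Rightarrow> ('g \<Rightarrow> 'g \<Rightarrow> 'g) \<Rightarrow>
   ('k \<Rightarrow> 'm::ab_group_add \<Rightarrow> 'm) \<Rightarrow> ('g \<Rightarrow> 'm \<Rightarrow> 'm) \<Rightarrow> bool" where
  "lie_module sg br sm act \<longleftrightarrow>
     vector_space sm \<and>
     (\<forall>a b x y m. act (sg a x + sg b y) m = sm a (act x m) + sm b (act y m)) \<and>
     (\<forall>a b x m m'. act x (sm a m + sm b m') = sm a (act x m) + sm b (act x m')) \<and>
     (\<forall>x y m. act (br x y) m = act x (act y m) - act y (act x m))"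

definition sgnp :: "nat \<Rightarrow> 'm::ab_group_add \<Rightarrow> 'm" where
  "sgnp i m = (if even i then m else - m)"

definition rem_at :: "nat \<Rightarrow> 'a list \<Rightarrow> 'a list" where
  "rem_at i xs = take i xs @ drop (Suc i) xs"

definition multilinear ::
  "('k::field \<Rightarrow> 'g::ab_group_add \<Rightarrow> 'g) \<Rightarrow> ('k \<Rightarrow> 'm::ab_group_add \<Rightarrow> 'm) \<Rightarrow> nat \<Rightarrow> ('g list \<Rightarrow> 'm) \<Rightarrow> bool" where
  "multilinear sg sm n f \<longleftrightarrow>
     (\<forall>xs ys a b u v. length xs + length ys + 1 = n \<longrightarrow>
        f (xs @ (sg a u + sg b v) # ys) = sm a (f (xs @ u # ys)) + sm b (f (xs @ v # ys)))"

definition L_cochains ::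
  "('k::field \<Rightarrow> 'g::ab_group_add \<Rightarrow> 'g) \<Rightarrow> ('k \<Rightarrow> 'm::ab_group_add \<Rightarrow> 'm) \<Rightarrow> nat \<Rightarrow> ('g list \<Rightarrow> 'm) set" where
  "L_cochains sg sm n = {f. (\<forall>zs. length zs \<noteq> n \<longrightarrow> f zs = 0) \<and> multilinear sg sm n f}"

definition CE_cochains ::
  "('k::field \<Rightarrow> 'g::ab_group_add \<Rightarrow> 'g) \<Rightarrow> ('k \<Rightarrow> 'm::ab_group_add \<Rightarrow> 'm) \<Rightarrow> nat \<Rightarrow> ('g list \<Rightarrow> 'm) set" where
  "CE_cochains sg sm n = {f. f \<in> L_cochains sg sm n \<and>
      (\<forall>zs i j. i < j \<and> j < length zs \<and> zs ! i = zs ! j \<longrightarrow> f zs = 0)}"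

definition CE_d ::
  "('g \<Rightarrow> 'g \<Rightarrow> 'g) \<Rightarrow> ('g \<Rightarrow> 'm::ab_group_add \<Rightarrow> 'm) \<Rightarrow> nat \<Rightarrow> ('g list \<Rightarrow> 'm) \<Rightarrow> ('g list \<Rightarrow> 'm)" where
  "CE_d br act n f = (\<lambda>zs. if length zs = Suc n then
      (\<Sum>i<Suc n. sgnp i (act (zs ! i) (f (rem_at i zs))))
    + (\<Sum>j<Suc n. \<Sum>i<j. sgnp (i + j) (f (br (zs ! i) (zs ! j) # rem_at i (rem_at j zs))))
    else 0)"

definition sym_right :: "('g \<Rightarrow> 'm::ab_group_add \<Rightarrow> 'm) \<Rightarrow> 'm \<Rightarrow> 'g \<Rightarrow> 'm" where
  "sym_right act m x = - act x m"

text \<open>Leibniz differential on CL^n(g,M_s), transcribed from the 1-based formula: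
 (d f)(x_1..x_{n+1}) = sum_{i=1}^n (-1)^(i+1) x_i . f(.. hat x_i ..) + (-1)^(n+1) f(x_1..x_n) . x_{n+1}
   + sum_{i<j} (-1)^i f(x_1,..,hat x_i,..,x_i x_j,..,x_{n+1})  (x_i x_j in position j).
 With 0-based index i the signs (-1)^(i+1+1) = (-1)^i and (-1)^(i+1) appear.\<close>
definition L_d ::
  "('g \<Rightarrow> 'g \<Rightarrow> 'g) \<Rightarrow> ('g \<Rightarrow> 'm::ab_group_add \<Rightarrow> 'm) \<Rightarrow> nat \<Rightarrow> ('g list \<Rightarrow> 'm) \<Rightarrow> ('g list \<Rightarrow> 'm)" where
  "L_d br act n f = (\<lambda>zs. if length zs = Suc n then
      (\<Sum>i<n. sgnp i (act (zs ! i) (f (rem_at i zs))))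
    + sgnp (Suc n) (sym_right act (f (take n zs)) (zs ! n))
    + (\<Sum>j<Suc n. \<Sum>i<j. sgnp (Suc i) (f (rem_at i (zs[j := br (zs ! i) (zs ! j)]))))
    else 0)"

definition cocycles :: "(nat \<Rightarrow> ('a \<Rightarrow> 'm::zero) set) \<Rightarrow> (nat \<Rightarrow> ('a \<Rightarrow> 'm) \<Rightarrow> ('a \<Rightarrow> 'm)) \<Rightarrow> nat \<Rightarrow> ('a \<Rightarrow> 'm) set" where
  "cocycles C d n = {f \<in> C n. d n f = (\<lambda>_. 0)}"

definition coboundaries :: "(nat \<Rightarrow> ('a \<Rightarrow> 'm::zero) set) \<Rightarrow> (nat \<Rightarrow> ('a \<Rightarrow> 'm) \<Rightarrow> ('a \<Rightarrow> 'm)) \<Rightarrow> nat \<Rightarrow> ('a \<Rightarrow> 'm) set" where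
  "coboundaries C d n = (if n = 0 then {\<lambda>_. 0} else d (n - 1) ` C (n - 1))"

definition cohom_zero :: "(nat \<Rightarrow> ('a \<Rightarrow> 'm::zero) set) \<Rightarrow> (nat \<Rightarrow> ('a \<Rightarrow> 'm) \<Rightarrow> ('a \<Rightarrow> 'm)) \<Rightarrow> nat \<Rightarrow> bool" where
  "cohom_zero C d n \<longleftrightarrow> cocycles C d n \<subseteq> coboundaries C d n"

text \<open>Isomorphism of quotient vector spaces Z1/B1 \<cong> Z2/B2 (B_i \<subseteq> Z_i subspaces of function spaces
with pointwise scalar multiplication by sm): a linear map Z1 \<rightarrow> Z2 mapping B1 into B2
whose induced map Z1/B1 \<rightarrow> Z2/B2 is injective and surjective.\<close>
definition quot_iso ::
  "('k::field \<Rightarrow> 'm::ab_group_add \<Rightarrow> 'm) \<Rightarrow> ('a \<Rightarrow> 'm) set \<Rightarrow> ('a \<Rightarrow> 'm) set \<Rightarrow>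
   ('b \<Rightarrow> 'm) set \<Rightarrow> ('b \<Rightarrow> 'm) set \<Rightarrow> bool" where
  "quot_iso sm Z1 B1 Z2 B2 \<longleftrightarrow>
     (\<exists>\<Phi>. (\<forall>z \<in> Z1. \<Phi> z \<in> Z2) \<and>
          (\<forall>a z w. z \<in> Z1 \<and> w \<in> Z1 \<longrightarrow>
              \<Phi> (\<lambda>x. sm a (z x) + w x) = (\<lambda>y. sm a (\<Phi> z y) + \<Phi> w y)) \<and>
          (\<forall>z \<in> Z1. \<Phi> z \<in> B2 \<longleftrightarrow> z \<in> B1) \<and>
          (\<forall>w \<in> Z2. \<exists>z \<in> Z1. (\<lambda>y. w y - \<Phi> z y) \<in> B2))"

definition CE_L_iso ::
  "('k::field \<Rightarrow> 'g::ab_group_add \<Rightarrow> 'g) \<Rightarrow> ('g \<Rightarrow> 'g \<Rightarrow> 'g) \<Rightarrow>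
   ('k \<Rightarrow> 'm::ab_group_add \<Rightarrow> 'm) \<Rightarrow> ('g \<Rightarrow> 'm \<Rightarrow> 'm) \<Rightarrow> nat \<Rightarrow> bool" where
  "CE_L_iso sg br sm act n \<longleftrightarrow>
     quot_iso sm (cocycles (CE_cochains sg sm) (CE_d br act) n) (coboundaries (CE_cochains sg sm) (CE_d br act) n)
                 (cocycles (L_cochains sg sm) (L_d br act) n) (coboundaries (L_cochains sg sm) (L_d br act) n)"

end

theory Submission
  imports Defs "HOL-Library.Function_Algebras"
begin

text \<open>Write \<open>i\<^sub>x\<close> for filling in the first argument of a cochain. Both differentials are determined by
  \<open>i\<^sub>x d = L\<^sub>x - d i\<^sub>x\<close>, so the Chevalley--Eilenberg complex \<open>C\<close> is the subcomplex of alternating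
  cochains of the Leibniz complex \<open>CL\<close>. The cochains alternating in the first \<open>p\<close> arguments form
  a decreasing filtration of \<open>CL\<close> by subcomplexes, from \<open>CL\<close> down to \<open>C\<close>. On such cochains, filling the
  first \<open>p + 1\<close> arguments with \<open>(x\<^sub>1, \<dots>, x\<^sub>p, x\<^sub>p)\<close> commutes with \<open>d\<close> up to sign. Hence if \<open>f\<close> of degree
  \<open>k\<close> is alternating in \<open>p\<close> arguments and \<open>d f\<close> in \<open>p + 1\<close>, all these values of \<open>f\<close> are cocycles in
  \<open>CL\<^sup>j\<close>, \<open>j = k - p - 1\<close>. If \<open>HL\<^sup>j = 0\<close>, a linear choice of primitives in the last \<open>j\<close> arguments
  gives a cochain \<open>g\<close> with \<open>f - d g\<close> alternating in \<open>p + 1\<close> arguments. Since \<open>p \<ge> 1\<close>, only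
  \<open>HL\<^sup>j\<close> with \<open>j \<le> k - 2\<close> occurs: if these vanish, every Leibniz cochain of degree \<open>k\<close> with
  alternating differential is alternating up to a coboundary.\<close>

section \<open>Signs, deleted arguments and double sums\<close>

lemma sgnp_simps [simp]:
  "sgnp 0 m = m"
  "sgnp (Suc i) m = - sgnp i m"
  "sgnp i 0 = (0 :: 'm::ab_group_add)"
  "sgnp i (- m) = - sgnp i m"
  "sgnp i (sgnp i m) = m"
  by (simp_all add: sgnp_def)

lemma rem_at_simps [simp]:
  "rem_at 0 (x # xs) = xs"
  "rem_at (Suc i) (x # xs) = x # rem_at i xs"
  by (simp_all add: rem_at_def)

text \<open>Separates the pairs containing the first argument from the others, matching the two
  terms in the recursion of \<open>cobd\<close>.\<close>

lemma sum_triangle_Suc: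
  fixes G :: "nat \<Rightarrow> nat \<Rightarrow> 'm::ab_group_add"
  shows "(\<Sum>j<Suc n. \<Sum>i<j. G i j) = (\<Sum>j<n. G 0 (Suc j)) + (\<Sum>j<n. \<Sum>i<j. G (Suc i) (Suc j))"
  by (simp add: sum.lessThan_Suc_shift sum.distrib del: sum.lessThan_Suc)

section \<open>Lie algebra and module; Lie derivative and differential of cochains\<close>

locale lie_rep =
  fixes sg :: "'k::field \<Rightarrow> 'g::ab_group_add \<Rightarrow> 'g"
    and br :: "'g \<Rightarrow> 'g \<Rightarrow> 'g"
    and sm :: "'k \<Rightarrow> 'm::ab_group_add \<Rightarrow> 'm"
    and act :: "'g \<Rightarrow> 'm \<Rightarrow> 'm"
  assumes lie_algebra: "lie_algebra sg br"
    and lie_module: "lie_module sg br sm act"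
begin

sublocale G: vector_space sg
  using lie_algebra by (simp add: lie_algebra_def)

sublocale M: vector_space sm
  using lie_module by (simp add: lie_module_def)

lemma br_lincomb_left: "br (sg a x + sg b y) z = sg a (br x z) + sg b (br y z)"
  and br_lincomb_right: "br z (sg a x + sg b y) = sg a (br z x) + sg b (br z y)"
  and br_self [simp]: "br x x = 0"
  and jacobi: "br x (br y z) + br y (br z x) + br z (br x y) = 0"
  using lie_algebra by (simp_all add: lie_algebra_def)

lemma act_lincomb_left: "act (sg a x + sg b y) m = sm a (act x m) + sm b (act y m)"
  and act_lincomb_right: "act x (sm a m + sm b m') = sm a (act x m) + sm b (act x m')"
  and act_br: "act (br x y) m = act x (act y m) - act y (act x m)"
  using lie_module by (simp_all add: lie_module_def)

lemma br_add_left: "br (x + y) z = br x z + br y z"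
  using br_lincomb_left[of 1 x 1 y] by simp

lemma br_add_right: "br z (x + y) = br z x + br z y"
  using br_lincomb_right[of z 1 x 1 y] by simp

lemma br_skew: "br x y = - br y x"
proof -
  have "br (x + y) (x + y) = br y x + br x y"
    unfolding br_add_left br_add_right by simp
  thus ?thesis by (simp add: eq_neg_iff_add_eq_0 add.commute)
qed

lemma br_minus_right: "br x (- y) = - br x y"
  using br_lincomb_right[of x "-1" y 0 0] by simp

lemma leibniz: "br (br x y) z = br x (br y z) - br y (br x z)"
proof -
  have "br x (br y z) + br y (br z x) + br z (br x y) = 0" by (rule jacobi)
  moreover have "br z (br x y) = - br (br x y) z" by (rule br_skew)
  moreover have "br y (br z x) = - br y (br x z)"
    using br_skew[of z x] br_minus_right by simp
  ultimately show ?thesis by (simp add: algebra_simps)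
qed

lemma act_add_right: "act x (m + m') = act x m + act x m'"
  using act_lincomb_right[of x 1 m 1 m'] by simp

lemma act_scale_right: "act x (sm a m) = sm a (act x m)"
  using act_lincomb_right[of x a m 0 m] by simp

lemma act_zero_right [simp]: "act x 0 = 0"
  using act_scale_right[of x 0 0] by simp

text \<open>The recursion is \<open>i_y L_x = L_x i_y - i_[x,y]\<close>. Peeling off the first
  argument turns identities between operators into inductions on the argument list with the cochain
  generalised.\<close>

primrec lie_deriv :: "'g \<Rightarrow> ('g list \<Rightarrow> 'm) \<Rightarrow> 'g list \<Rightarrow> 'm" where
  "lie_deriv x f [] = act x (f [])"
| "lie_deriv x f (y # zs) = lie_deriv x (\<lambda>ws. f (y # ws)) zs - f (br x y # zs)"

text \<open>The differential in all degrees at once. Its recursion is the Cartan formula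
  \<open>i\<^sub>x d = L\<^sub>x - d i\<^sub>x\<close>, where \<open>i\<^sub>x\<close> fills in the first argument; cochains of both complexes
  satisfy it.\<close>
primrec cobd :: "('g list \<Rightarrow> 'm) \<Rightarrow> 'g list \<Rightarrow> 'm" where
  "cobd f [] = 0"
| "cobd f (x # zs) = lie_deriv x f zs - cobd (\<lambda>ws. f (x # ws)) zs"

lemma lie_deriv_lin:
  "lie_deriv x (\<lambda>zs. sm a (f zs) + g zs) zs = sm a (lie_deriv x f zs) + lie_deriv x g zs"
  by (induction zs arbitrary: f g)
    (simp_all add: act_add_right act_scale_right M.scale_right_diff_distrib)

lemma cobd_lin: "cobd (\<lambda>zs. sm a (f zs) + g zs) zs = sm a (cobd f zs) + cobd g zs"
  by (induction zs arbitrary: f g)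
    (simp_all add: lie_deriv_lin M.scale_right_diff_distrib)

lemma lie_deriv_zero [simp]: "lie_deriv x (\<lambda>_. 0) zs = 0"
  using lie_deriv_lin[of x 0 "\<lambda>_. 0" "\<lambda>_. 0" zs] by (induction zs) simp_all

lemma cobd_zero [simp]: "cobd (\<lambda>_. 0) zs = 0"
  by (induction zs) simp_all

lemma lie_deriv_add: "lie_deriv x (\<lambda>zs. f zs + g zs) zs = lie_deriv x f zs + lie_deriv x g zs"
  using lie_deriv_lin[of x 1 f g zs] by simp

lemma lie_deriv_scale: "lie_deriv x (\<lambda>zs. sm a (f zs)) zs = sm a (lie_deriv x f zs)"
  using lie_deriv_lin[of x a f "\<lambda>_. 0" zs] by simp

lemma lie_deriv_diff: "lie_deriv x (\<lambda>zs. f zs - g zs) zs = lie_deriv x f zs - lie_deriv x g zs"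
  using lie_deriv_lin[of x "-1" g f zs] by simp

lemma cobd_add: "cobd (\<lambda>zs. f zs + g zs) zs = cobd f zs + cobd g zs"
  using cobd_lin[of 1 f g zs] by simp

lemma cobd_scale: "cobd (\<lambda>zs. sm a (f zs)) zs = sm a (cobd f zs)"
  using cobd_lin[of a f "\<lambda>_. 0" zs] by simp

lemma cobd_minus: "cobd (\<lambda>zs. - f zs) zs = - cobd f zs"
  using cobd_scale[of "-1" f zs] by simp

lemma cobd_diff: "cobd (\<lambda>zs. f zs - g zs) zs = cobd f zs - cobd g zs"
  using cobd_lin[of "-1" g f zs] by simp

text \<open>Unlike \<open>multilinear\<close>, this carries no degree, so filling in arguments
  preserves it without bookkeeping. For functions supported on lists of one length both notions
  agree, see \<open>L_cochains_iff\<close>.\<close>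

definition mlin :: "('g list \<Rightarrow> 'm) \<Rightarrow> bool" where
  "mlin f \<longleftrightarrow> (\<forall>xs ys a b u v.
     f (xs @ (sg a u + sg b v) # ys) = sm a (f (xs @ u # ys)) + sm b (f (xs @ v # ys)))"

lemma mlinD:
  "mlin f \<Longrightarrow> f (xs @ (sg a u + sg b v) # ys) = sm a (f (xs @ u # ys)) + sm b (f (xs @ v # ys))"
  by (simp add: mlin_def)

lemma mlin_hd:
  "mlin f \<Longrightarrow> f ((sg a u + sg b v) # ys) = sm a (f (u # ys)) + sm b (f (v # ys))"
  using mlinD[of f "[]"] by simp

lemma mlin_hd_diff: "mlin f \<Longrightarrow> f ((u - v) # ys) = f (u # ys) - f (v # ys)"
  using mlin_hd[of f 1 u "-1" v ys] by simp

lemma mlin_hd_zero: "mlin f \<Longrightarrow> f (0 # ys) = 0"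
  using mlin_hd_diff[of f 0 0 ys] by simp

lemma mlin_add: "mlin f \<Longrightarrow> f (xs @ (u + v) # ys) = f (xs @ u # ys) + f (xs @ v # ys)"
  using mlinD[of f xs 1 u 1 v ys] by simp

lemma mlin_zero [simp]: "mlin (\<lambda>_. 0)"
  by (simp add: mlin_def)

lemma mlin_lin: "mlin f \<Longrightarrow> mlin g \<Longrightarrow> mlin (\<lambda>zs. sm c (f zs) + g zs)"
  by (simp add: mlin_def algebra_simps M.scale_right_distrib)

lemma mlin_diff: "mlin f \<Longrightarrow> mlin g \<Longrightarrow> mlin (\<lambda>zs. f zs - g zs)"
  by (simp add: mlin_def algebra_simps M.scale_right_diff_distrib)

lemma mlin_append: "mlin f \<Longrightarrow> mlin (\<lambda>ws. f (us @ ws))"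
  unfolding mlin_def by (metis append.assoc)

lemma mlin_Cons: "mlin f \<Longrightarrow> mlin (\<lambda>ws. f (x # ws))"
  using mlin_append[of f "[x]"] by simp

section \<open>Cartan relations and \<open>d d = 0\<close>\<close>

lemma lie_deriv_lincomb:
  "mlin f \<Longrightarrow> lie_deriv (sg a u + sg b v) f zs = sm a (lie_deriv u f zs) + sm b (lie_deriv v f zs)"
proof (induction zs arbitrary: f)
  case (Cons z zs)
  then show ?case
    using Cons.IH[OF mlin_Cons[OF Cons.prems]]
    by (simp add: br_lincomb_left mlin_hd M.scale_right_diff_distrib)
qed (simp add: act_lincomb_left)

lemma mlin_lie_deriv:
  assumes "mlin f"
  shows "mlin (lie_deriv x f)"
proof -
  have "lie_deriv x f (xs @ (sg a u + sg b v) # ys) =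
      sm a (lie_deriv x f (xs @ u # ys)) + sm b (lie_deriv x f (xs @ v # ys))"
    if "mlin f" for xs ys a b u v f
    using that
  proof (induction xs arbitrary: f)
    case Nil
    then show ?case
      by (simp add: mlin_hd lie_deriv_add lie_deriv_scale br_lincomb_right
          M.scale_right_diff_distrib)
  next
    case (Cons z xs)
    then show ?case
      using Cons.IH[OF mlin_Cons[OF Cons.prems]] mlinD[OF Cons.prems, of "_ # xs"]
      by (simp add: M.scale_right_diff_distrib)
  qed
  with assms show ?thesis by (simp add: mlin_def)
qed

lemma mlin_cobd:
  assumes "mlin f"
  shows "mlin (cobd f)"
proof -
  have "cobd f (xs @ (sg a u + sg b v) # ys) =
      sm a (cobd f (xs @ u # ys)) + sm b (cobd f (xs @ v # ys))"
    if "mlin f" for xs ys a b u v f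
    using that
  proof (induction xs arbitrary: f)
    case Nil
    then show ?case
      by (simp add: mlin_hd lie_deriv_lincomb cobd_add cobd_scale M.scale_right_diff_distrib)
  next
    case (Cons z xs)
    then show ?case
      using Cons.IH[OF mlin_Cons[OF Cons.prems]] mlinD[OF mlin_lie_deriv[OF Cons.prems]]
      by (simp add: M.scale_right_diff_distrib)
  qed
  with assms show ?thesis by (simp add: mlin_def)
qed

text \<open>Filling \<open>z\<close> into \<open>L_x L_y f\<close> gives two mixed terms, with
  \<open>[x,z]\<close> and \<open>[y,z]\<close>, whose sum is symmetric in \<open>x\<close> and
  \<open>y\<close>. They cancel in the commutator, and the doubly bracketed terms combine by
  \<open>leibniz\<close>.\<close>

lemma lie_deriv_br:
  "mlin f \<Longrightarrow>
   lie_deriv (br x y) f zs = lie_deriv x (lie_deriv y f) zs - lie_deriv y (lie_deriv x f) zs"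
proof (induction zs arbitrary: f)
  case (Cons z zs)
  then show ?case
    using Cons.IH[OF mlin_Cons[OF Cons.prems]]
    by (simp add: lie_deriv_diff leibniz mlin_hd_diff)
qed (simp add: act_br)

text \<open>Filling in \<open>z\<close> on both sides leaves exactly the relation
  \<open>lie_deriv_br\<close> for \<open>x\<close> and \<open>z\<close>.\<close>

lemma lie_deriv_cobd:
  "mlin f \<Longrightarrow> lie_deriv x (cobd f) zs = cobd (lie_deriv x f) zs"
proof (induction zs arbitrary: f)
  case (Cons z zs)
  then show ?case
    using Cons.IH[OF mlin_Cons[OF Cons.prems]]
    by (simp add: lie_deriv_diff lie_deriv_br cobd_diff)
qed simp

text \<open>The Cartan formula gives \<open>i_x d d = L_x d - d L_x + d d i_x\<close>; the first two
  terms cancel and the last vanishes by induction.\<close>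

lemma cobd_square: "mlin f \<Longrightarrow> cobd (cobd f) zs = 0"
  by (induction zs arbitrary: f)
    (simp_all add: lie_deriv_cobd cobd_diff mlin_Cons)

section \<open>Cochains alternating in their first arguments\<close>

text \<open>Adjacent equal arguments among the first \<open>p\<close> suffice: a multilinear map with this
  property is alternating in its first \<open>p\<close> arguments.\<close>
definition alt :: "nat \<Rightarrow> ('g list \<Rightarrow> 'm) \<Rightarrow> bool" where
  "alt p f \<longleftrightarrow> (\<forall>xs x ys. length xs + 2 \<le> p \<longrightarrow> f (xs @ x # x # ys) = 0)"

lemma altD: "alt p f \<Longrightarrow> length xs + 2 \<le> p \<Longrightarrow> f (xs @ x # x # ys) = 0"
  by (simp add: alt_def)

lemma alt_mono: "alt p f \<Longrightarrow> q \<le> p \<Longrightarrow> alt q f"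
  by (auto simp: alt_def)

lemma alt_Cons: "alt (Suc p) f \<Longrightarrow> alt p (\<lambda>ws. f (x # ws))"
  unfolding alt_def by (metis add_Suc append_Cons length_Cons not_less_eq_eq add_2_eq_Suc')

lemma alt_swap:
  assumes "mlin f" "alt p f" "length xs + 2 \<le> p"
  shows "f (xs @ x # y # ys) = - f (xs @ y # x # ys)"
proof -
  have "0 = f (xs @ (x + y) # (x + y) # ys)"
    using altD[OF assms(2,3)] by simp
  also have "\<dots> = f (xs @ x # y # ys) + f (xs @ y # x # ys)"
    using mlin_add[OF assms(1), of xs x y "(x + y) # ys"]
      mlin_add[OF assms(1), of "xs @ [x]" x y ys] mlin_add[OF assms(1), of "xs @ [y]" x y ys]
      altD[OF assms(2,3)] by simp
  finally show ?thesis by (simp add: eq_neg_iff_add_eq_0)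
qed

text \<open>The only terms without an adjacent pair \<open>x, x\<close> are the two in which one
  copy of \<open>x\<close> becomes \<open>[a,x]\<close>, and these cancel by
  \<open>alt_swap\<close>.\<close>

lemma alt_lie_deriv:
  assumes "mlin f" "alt p f"
  shows "alt p (lie_deriv a f)"
proof -
  have "lie_deriv a f (xs @ x # x # ys) = 0"
    if "mlin f" "alt p f" "length xs + 2 \<le> p" for xs x ys p f
    using that
  proof (induction xs arbitrary: f p)
    case Nil
    then show ?case
      using altD[of p f "[]" x] alt_swap[OF Nil(1,2), of "[]" x "br a x" ys] by simp
  next
    case (Cons z xs)
    then obtain q where "p = Suc q" by (cases p) auto
    then show ?case
      using Cons.IH[OF mlin_Cons[OF Cons.prems(1)] alt_Cons, of q] Cons.prems
        altD[of p f "_ # xs"] by simp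
  qed
  with assms show ?thesis by (auto simp: alt_def)
qed

text \<open>Moving \<open>d\<close> past the arguments \<open>xs @ [x, x]\<close> produces Lie derivatives. Those along \<open>xs\<close> still
  have \<open>[x, x]\<close> among the alternating arguments, and the two along \<open>x\<close> cancel because \<open>[x, x] = 0\<close>.\<close>
lemma cobd_repeated:
  "mlin f \<Longrightarrow> alt (Suc (length xs)) f \<Longrightarrow>
   cobd f (xs @ x # x # ys) = sgnp (length xs) (cobd (\<lambda>ws. f (xs @ x # x # ws)) ys)"
proof (induction xs arbitrary: f)
  case Nil
  then show ?case by (simp add: cobd_diff mlin_hd_zero)
next
  case (Cons z xs)
  have "lie_deriv z f (xs @ x # x # ys) = 0"
    using altD[OF alt_lie_deriv[OF Cons.prems]] by simp
  then show ?case
    using Cons.IH[OF mlin_Cons[OF Cons.prems(1)] alt_Cons] Cons.prems by simp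
qed

text \<open>The filtration consists of subcomplexes: filling a repeated pair into \<open>f\<close>
  gives the zero cochain, and \<open>cobd_repeated\<close> passes this on to
  \<open>cobd f\<close>.\<close>

lemma alt_cobd:
  assumes "mlin f" "alt p f"
  shows "alt p (cobd f)"
  unfolding alt_def
proof (intro allI impI)
  fix xs :: "'g list" and x ys
  assume le: "length xs + 2 \<le> p"
  have "(\<lambda>ws. f (xs @ x # x # ws)) = (\<lambda>_. 0)"
    using altD[OF assms(2) le] by simp
  then show "cobd f (xs @ x # x # ys) = 0"
    using cobd_repeated[OF assms(1) alt_mono[OF assms(2)], of xs x ys] le by simp
qed


section \<open>Agreement with the given cochains and differentials\<close>

lemma alt_repeated:
  assumes "mlin f" "alt p f"
  shows "length us + length bs + 2 \<le> p \<Longrightarrow> f (us @ x # bs @ x # cs) = 0"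
proof (induction bs arbitrary: us)
  case Nil
  then show ?case using altD[OF assms(2)] by simp
next
  case (Cons b bs)
  then show ?case
    using alt_swap[OF assms, of us x b "bs @ x # cs"] Cons.IH[of "us @ [b]"] by simp
qed

lemma alt_move_front:
  assumes "mlin f" "alt p f"
  shows "length us < p \<Longrightarrow> f (us @ w # vs) = sgnp (length us) (f (w # us @ vs))"
proof (induction us arbitrary: vs rule: rev_induct)
  case (snoc u us)
  then show ?case
    using alt_swap[OF assms, of us u w vs] by simp
qed simp

text \<open>Moves the bracket from its place in the Leibniz differential to the front, where the
  Chevalley--Eilenberg differential has it.\<close>

lemma alt_update:
  assumes "mlin f" "alt p f" "j < length zs" "length zs \<le> p"
  shows "f (zs[j := w]) = sgnp j (f (w # rem_at j zs))"
  using alt_move_front[OF assms(1,2), of "take j zs" w "drop (Suc j) zs"] assms(3,4)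
  by (simp add: upd_conv_take_nth_drop rem_at_def min_def)

lemma L_cochains_iff:
  "f \<in> L_cochains sg sm n \<longleftrightarrow> (\<forall>zs. length zs \<noteq> n \<longrightarrow> f zs = 0) \<and> mlin f"
  (is "_ \<longleftrightarrow> ?S \<and> _")
proof -
  have "multilinear sg sm n f \<longleftrightarrow> mlin f" if ?S
    unfolding multilinear_def mlin_def
  proof (intro iffI allI impI)
    fix xs ys a b u v
    assume H: "\<forall>xs ys a b u v. length xs + length ys + 1 = n \<longrightarrow>
      f (xs @ (sg a u + sg b v) # ys) = sm a (f (xs @ u # ys)) + sm b (f (xs @ v # ys))"
    show "f (xs @ (sg a u + sg b v) # ys) = sm a (f (xs @ u # ys)) + sm b (f (xs @ v # ys))"
      using H that by (cases "length xs + length ys + 1 = n") simp_all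
  qed simp
  then show ?thesis by (auto simp: L_cochains_def)
qed

lemma CE_cochains_iff: "f \<in> CE_cochains sg sm n \<longleftrightarrow> f \<in> L_cochains sg sm n \<and> alt n f"
proof (intro iffI conjI)
  assume f: "f \<in> CE_cochains sg sm n"
  then show "f \<in> L_cochains sg sm n" by (simp add: CE_cochains_def)
  show "alt n f"
    unfolding alt_def
  proof (intro allI impI)
    fix xs :: "'g list" and x ys
    have "(xs @ x # x # ys) ! length xs = (xs @ x # x # ys) ! Suc (length xs)"
      by (simp add: nth_append)
    moreover have "length xs < Suc (length xs)" "Suc (length xs) < length (xs @ x # x # ys)"
      by simp_all
    ultimately show "f (xs @ x # x # ys) = 0"
      using f unfolding CE_cochains_def by blast
  qed
next
  assume f: "f \<in> L_cochains sg sm n \<and> alt n f"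
  have "f zs = 0" if "i < j" "j < length zs" "zs ! i = zs ! j" for zs i j
  proof (cases "length zs = n")
    case True
    define us where "us = take i zs"
    define bs where "bs = take (j - Suc i) (drop (Suc i) zs)"
    define cs where "cs = drop (Suc j) zs"
    have "zs = us @ zs ! i # drop (Suc i) zs"
      using that(1,2) unfolding us_def by (intro id_take_nth_drop) simp
    moreover have "drop (Suc i) zs = bs @ zs ! j # cs"
      using id_take_nth_drop[of "j - Suc i" "drop (Suc i) zs"] that
      by (simp add: bs_def cs_def)
    ultimately have eq: "zs = us @ zs ! i # bs @ zs ! i # cs"
      using that(3) by simp
    have "length us + length bs + 2 \<le> n"
      using that True by (simp add: us_def bs_def)
    then show ?thesis
      using f alt_repeated[of f n us bs "zs ! i" cs] eq by (simp add: L_cochains_iff)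
  next
    case False
    with f show ?thesis by (simp add: L_cochains_iff)
  qed
  with f show "f \<in> CE_cochains sg sm n" by (auto simp: CE_cochains_def)
qed

lemma lie_deriv_sum:
  "lie_deriv x f zs = act x (f zs) - (\<Sum>j<length zs. f (zs[j := br x (zs ! j)]))"
  by (induction zs arbitrary: f)
    (simp_all add: sum.lessThan_Suc_shift algebra_simps del: sum.lessThan_Suc)

lemma cobd_sum:
  "cobd f zs = (\<Sum>i<length zs. sgnp i (act (zs ! i) (f (rem_at i zs))))
     + (\<Sum>j<length zs. \<Sum>i<j. sgnp (Suc i) (f (rem_at i (zs[j := br (zs ! i) (zs ! j)]))))"
proof (induction zs arbitrary: f)
  case (Cons x zs)
  show ?case
    by (simp add: Cons.IH lie_deriv_sum sum_triangle_Suc sum.lessThan_Suc_shift sum_negf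
        del: sum.lessThan_Suc)
qed simp

text \<open>The length bound places all arguments of \<open>f\<close> on the right within its
  alternating range. In the induction, brackets with \<open>x\<close> move to the front by
  \<open>alt_update\<close>, and the other brackets are exchanged with \<open>x\<close> at the cost
  of one sign.\<close>

lemma cobd_sum_alt:
  "mlin f \<Longrightarrow> alt p f \<Longrightarrow> length zs \<le> Suc p \<Longrightarrow>
   cobd f zs = (\<Sum>i<length zs. sgnp i (act (zs ! i) (f (rem_at i zs))))
     + (\<Sum>j<length zs. \<Sum>i<j. sgnp (i + j) (f (br (zs ! i) (zs ! j) # rem_at i (rem_at j zs))))"
proof (induction zs arbitrary: f p)
  case (Cons x zs)
  have swap: "f (y # x # ws) = - f (x # y # ws)" if "2 \<le> p" for y ws
    using alt_swap[OF Cons.prems(1,2), of "[]" y x ws] that by simp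
  have IH: "cobd (\<lambda>ws. f (x # ws)) zs =
     (\<Sum>i<length zs. sgnp i (act (zs ! i) (f (x # rem_at i zs))))
     + (\<Sum>j<length zs. \<Sum>i<j. sgnp (i + j) (f (x # br (zs ! i) (zs ! j) # rem_at i (rem_at j zs))))"
  proof (cases p)
    case 0
    then show ?thesis using Cons.prems by simp
  next
    case (Suc q)
    then show ?thesis
      using Cons.IH[OF mlin_Cons[OF Cons.prems(1)] alt_Cons, of q] Cons.prems by simp
  qed
  have front: "(\<Sum>j<length zs. f (zs[j := br x (zs ! j)])) =
      (\<Sum>j<length zs. sgnp j (f (br x (zs ! j) # rem_at j zs)))"
    using Cons.prems(3) by (intro sum.cong) (simp_all add: alt_update[OF Cons.prems(1,2)])
  have rest: "(\<Sum>j<length zs. \<Sum>i<j. sgnp (i + j) (f (br (zs ! i) (zs ! j) # x # rem_at i (rem_at j zs)))) =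
      - (\<Sum>j<length zs. \<Sum>i<j. sgnp (i + j) (f (x # br (zs ! i) (zs ! j) # rem_at i (rem_at j zs))))"
    unfolding sum_negf[symmetric]
    using Cons.prems(3) by (intro sum.cong) (simp_all add: swap)
  show ?case
    by (simp add: IH front rest lie_deriv_sum sum_triangle_Suc sum.lessThan_Suc_shift sum_negf
        del: sum.lessThan_Suc)
qed simp

lemma cobd_support:
  "(\<And>zs. length zs \<noteq> n \<Longrightarrow> f zs = 0) \<Longrightarrow> length zs \<noteq> Suc n \<Longrightarrow> cobd f zs = 0"
proof (induction zs arbitrary: f n)
  case (Cons x zs)
  have "cobd (\<lambda>ws. f (x # ws)) zs = 0"
  proof (cases n)
    case 0
    then show ?thesis using Cons.prems(1) by simp
  next
    case (Suc m)
    then show ?thesis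
      using Cons.IH[of m "\<lambda>ws. f (x # ws)"] Cons.prems by simp
  qed
  then show ?case using Cons.prems by (simp add: lie_deriv_sum)
qed simp

lemma L_d_eq:
  assumes "f \<in> L_cochains sg sm n"
  shows "L_d br act n f = cobd f"
proof
  fix zs
  show "L_d br act n f zs = cobd f zs"
  proof (cases "length zs = Suc n")
    case True
    \<comment> \<open>In the symmetric bimodule the right action term is the missing summand
      \<open>i = n\<close> of the first sum in \<open>cobd_sum\<close>.\<close>
    then show ?thesis
      by (simp add: L_d_def cobd_sum sym_right_def rem_at_def)
  next
    case False
    then show ?thesis
      using assms cobd_support[of n f zs] by (auto simp: L_d_def L_cochains_iff)
  qed
qed

lemma CE_d_eq:
  assumes "f \<in> CE_cochains sg sm n"
  shows "CE_d br act n f = cobd f"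
proof
  fix zs
  show "CE_d br act n f zs = cobd f zs"
  proof (cases "length zs = Suc n")
    case True
    then show ?thesis
      using assms cobd_sum_alt[of f n zs] by (simp add: CE_d_def CE_cochains_iff L_cochains_iff)
  next
    case False
    then show ?thesis
      using assms cobd_support[of n f zs]
      by (auto simp: CE_d_def CE_cochains_iff L_cochains_iff)
  qed
qed

lemma L_cochains_zero: "(\<lambda>_. 0) \<in> L_cochains sg sm n"
  by (simp add: L_cochains_iff)

lemma L_cochains_lin:
  "f \<in> L_cochains sg sm n \<Longrightarrow> g \<in> L_cochains sg sm n \<Longrightarrow>
   (\<lambda>zs. sm a (f zs) + g zs) \<in> L_cochains sg sm n"
  by (simp add: L_cochains_iff mlin_lin)

lemma L_cochains_diff:
  "f \<in> L_cochains sg sm n \<Longrightarrow> g \<in> L_cochains sg sm n \<Longrightarrow>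
   (\<lambda>zs. f zs - g zs) \<in> L_cochains sg sm n"
  by (simp add: L_cochains_iff mlin_diff)

lemma cobd_L_cochains: "f \<in> L_cochains sg sm n \<Longrightarrow> cobd f \<in> L_cochains sg sm (Suc n)"
  using cobd_support[of n f] by (auto simp: L_cochains_iff mlin_cobd)

lemma CE_subset_L: "f \<in> CE_cochains sg sm n \<Longrightarrow> f \<in> L_cochains sg sm n"
  by (simp add: CE_cochains_iff)

section \<open>Cocycles and coboundaries of both complexes\<close>

abbreviation "ZL \<equiv> cocycles (L_cochains sg sm) (L_d br act)"
abbreviation "BL \<equiv> coboundaries (L_cochains sg sm) (L_d br act)"
abbreviation "ZCE \<equiv> cocycles (CE_cochains sg sm) (CE_d br act)"
abbreviation "BCE \<equiv> coboundaries (CE_cochains sg sm) (CE_d br act)"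
abbreviation "HL_zero \<equiv> cohom_zero (L_cochains sg sm) (L_d br act)"
abbreviation "HCE_zero \<equiv> cohom_zero (CE_cochains sg sm) (CE_d br act)"

lemma ZL_iff: "f \<in> ZL n \<longleftrightarrow> f \<in> L_cochains sg sm n \<and> (\<forall>zs. cobd f zs = 0)"
  by (auto simp: cocycles_def L_d_eq)

lemma ZCE_iff: "f \<in> ZCE n \<longleftrightarrow> f \<in> CE_cochains sg sm n \<and> (\<forall>zs. cobd f zs = 0)"
  by (auto simp: cocycles_def CE_d_eq)

lemma ZCE_subset_ZL: "f \<in> ZCE n \<Longrightarrow> f \<in> ZL n"
  by (simp add: ZCE_iff ZL_iff CE_subset_L)

lemma BL_Suc: "BL (Suc n) = cobd ` L_cochains sg sm n"
  by (simp add: coboundaries_def L_d_eq)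

lemma BCE_Suc: "BCE (Suc n) = cobd ` CE_cochains sg sm n"
  by (simp add: coboundaries_def CE_d_eq)

lemma BL_0: "BL 0 = {\<lambda>_. 0}" and BCE_0: "BCE 0 = {\<lambda>_. 0}"
  by (simp_all add: coboundaries_def)

lemma zero_in_BL: "(\<lambda>_. 0) \<in> BL n"
  using L_cochains_zero[of "n - 1"]
  by (cases n) (auto simp: BL_0 BL_Suc intro!: image_eqI[of _ _ "\<lambda>_. 0"])

lemma BL_subset_ZL: "f \<in> BL n \<Longrightarrow> f \<in> ZL n"
  by (cases n)
    (auto simp: BL_0 BL_Suc ZL_iff L_cochains_zero cobd_L_cochains intro!: cobd_square
      dest: L_cochains_iff[THEN iffD1])

lemma BCE_subset_BL: "f \<in> BCE n \<Longrightarrow> f \<in> BL n"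
  by (cases n) (auto simp: BL_0 BL_Suc BCE_0 BCE_Suc CE_subset_L)

lemma BL_add:
  assumes "f \<in> BL n" "g \<in> BL n"
  shows "(\<lambda>zs. f zs + g zs) \<in> BL n"
proof (cases n)
  case 0
  with assms show ?thesis by (simp add: BL_0)
next
  case (Suc m)
  with assms obtain f' g' where fg: "f' \<in> L_cochains sg sm m" "g' \<in> L_cochains sg sm m"
    "f = cobd f'" "g = cobd g'"
    by (auto simp: BL_Suc)
  have "(\<lambda>zs. f zs + g zs) = cobd (\<lambda>zs. f' zs + g' zs)"
    by (simp add: fg cobd_add fun_eq_iff)
  moreover have "(\<lambda>zs. f' zs + g' zs) \<in> L_cochains sg sm m"
    using L_cochains_lin[OF fg(1,2), of 1] by simp
  ultimately show ?thesis by (simp add: Suc BL_Suc)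
qed

section \<open>Making cochains alternating, one argument at a time\<close>

lemma cobd_section:
  assumes "(\<lambda>_. 0) \<in> V"
    and "\<And>a f g. f \<in> V \<Longrightarrow> g \<in> V \<Longrightarrow> (\<lambda>zs. sm a (f zs) + g zs) \<in> V"
  shows "\<exists>\<sigma>. (\<forall>f. \<sigma> f \<in> V) \<and>
    (\<forall>a b f g. \<sigma> (\<lambda>zs. sm a (f zs) + sm b (g zs)) = (\<lambda>zs. sm a (\<sigma> f zs) + sm b (\<sigma> g zs))) \<and>
    (\<forall>v \<in> V. cobd (\<sigma> (cobd v)) = cobd v)"
proof -
  let ?s = "\<lambda>a (f :: 'g list \<Rightarrow> 'm) zs. sm a (f zs)"
  interpret F: vector_space ?s
    by unfold_locales (simp_all add: fun_eq_iff M.scale_right_distrib M.scale_left_distrib)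
  interpret FF: vector_space_pair ?s ?s ..
  have "Vector_Spaces.linear ?s ?s cobd"
    unfolding linear_iff
    by (simp add: F.vector_space_axioms fun_eq_iff plus_fun_def cobd_add cobd_scale)
  moreover have "F.subspace V"
  proof (rule F.subspaceI)
    show "0 \<in> V" using assms(1) by (simp add: zero_fun_def)
    fix f g a
    assume "f \<in> V" "g \<in> V"
    then show "f + g \<in> V" using assms(2)[of f g 1] by (simp add: plus_fun_def)
  next
    fix f a
    assume "f \<in> V"
    then show "?s a f \<in> V" using assms(2)[OF _ assms(1), of f a] by simp
  qed
  \<comment> \<open>A linear right inverse of \<open>cobd\<close> on the image of \<open>V\<close>,
    extended to all functions on lists. Its linearity will make the cochain \<open>g\<close> of
    \<open>alt_step\<close> multilinear in the arguments passed to \<open>f\<close>.\<close>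
  ultimately obtain \<sigma> where \<sigma>: "range \<sigma> \<subseteq> V" "Vector_Spaces.linear ?s ?s \<sigma>"
    "\<forall>v \<in> cobd ` V. cobd (\<sigma> v) = v"
    using FF.linear_exists_right_inverse_on by blast
  have "\<sigma> (?s a f + ?s b g) = ?s a (\<sigma> f) + ?s b (\<sigma> g)" for a b f g
    using \<sigma>(2) by (simp add: linear_iff)
  then have "\<sigma> (\<lambda>zs. sm a (f zs) + sm b (g zs)) = (\<lambda>zs. sm a (\<sigma> f zs) + sm b (\<sigma> g zs))" for a b f g
    by (simp add: plus_fun_def)
  with \<sigma>(1,3) show ?thesis by blast
qed

lemma alt_step:
  assumes f: "f \<in> L_cochains sg sm k" "alt p f" and p: "0 < p" "p < k"
    and df: "alt (Suc p) (cobd f)"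
    and HL: "HL_zero (k - Suc p)"
  shows "\<exists>g \<in> L_cochains sg sm (k - 1). alt (Suc p) (\<lambda>zs. f zs - cobd g zs)"
proof -
  obtain q where q: "p = Suc q" using p by (cases p) auto
  define j where "j = k - Suc p"
  \<comment> \<open>For \<open>j = 0\<close> there are no cochains of degree \<open>j - 1\<close>;
    the zero space takes their place, in accordance with \<open>BL 0\<close> being zero.\<close>
  define V where "V = (if j = 0 then {\<lambda>_. 0} else L_cochains sg sm (j - 1))"
  have BV: "BL j = cobd ` V"
    by (cases j) (simp_all add: V_def BL_0 BL_Suc)
  have V0: "(\<lambda>_. 0) \<in> V" by (simp add: V_def L_cochains_zero)
  have Vlin: "(\<lambda>zs. sm a (f zs) + g zs) \<in> V" if "f \<in> V" "g \<in> V" for a f g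
    using that by (auto simp: V_def L_cochains_lin split: if_splits)
  obtain \<sigma> where \<sigma>V: "\<And>f. \<sigma> f \<in> V"
    and \<sigma>lin: "\<And>a b f g. \<sigma> (\<lambda>zs. sm a (f zs) + sm b (g zs)) =
        (\<lambda>zs. sm a (\<sigma> f zs) + sm b (\<sigma> g zs))"
    and \<sigma>d: "\<And>v. v \<in> V \<Longrightarrow> cobd (\<sigma> (cobd v)) = cobd v"
  proof -
    have "\<exists>\<sigma>. (\<forall>f. \<sigma> f \<in> V) \<and>
        (\<forall>a b f g. \<sigma> (\<lambda>zs. sm a (f zs) + sm b (g zs)) = (\<lambda>zs. sm a (\<sigma> f zs) + sm b (\<sigma> g zs))) \<and>
        (\<forall>v \<in> V. cobd (\<sigma> (cobd v)) = cobd v)"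
      by (rule cobd_section) (simp_all add: V0 Vlin)
    with that show thesis by blast
  qed
  have \<sigma>0: "\<sigma> (\<lambda>_. 0) = (\<lambda>_. 0)"
    using \<sigma>lin[of 0 "\<lambda>_. 0" 0 "\<lambda>_. 0"] by simp
  have fm: "mlin f" and f0: "\<And>zs. length zs \<noteq> k \<Longrightarrow> f zs = 0"
    using f by (simp_all add: L_cochains_iff)
  have \<sigma>m: "mlin (\<sigma> v)" for v
    using \<sigma>V[of v] by (auto simp: V_def L_cochains_iff split: if_splits)
  \<comment> \<open>The first \<open>p + 1\<close> arguments are fixed in \<open>f\<close>, and
    \<sigma> is applied to the resulting cochain of degree \<open>j\<close>, so \<open>g\<close> has
    degree \<open>(p + 1) + (j - 1) = k - 1\<close>. A primitive is guaranteed only for heads ending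
    in a repeated argument, but \<sigma> is defined for all heads. The sign cancels the one in
    \<open>cobd_repeated\<close>.\<close>
  define g where "g = (\<lambda>zs. if Suc p \<le> length zs
    then sgnp q (\<sigma> (\<lambda>ys. f (take (Suc p) zs @ ys)) (drop (Suc p) zs)) else 0)"
  have sgnp_lin: "sgnp q (sm a m + sm b m') = sm a (sgnp q m) + sm b (sgnp q m')" for a b m m'
    by (simp add: sgnp_def)
  have g_head: "g (us @ ys) = sgnp q (\<sigma> (\<lambda>ws. f (us @ ws)) ys)" if "length us = Suc p" for us ys
    using that by (simp add: g_def)
  have "mlin g"
    unfolding mlin_def
  proof (intro allI)
    fix xs ys :: "'g list" and a b u v
    \<comment> \<open>The varied argument lies in a list on which \<open>g\<close> is zero, among
      the arguments of the value of \<sigma>, or among those fixed in \<open>f\<close>. The last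
      case uses linearity of \<sigma>.\<close>
    consider (short) "length xs + length ys < p"
      | (tail) "Suc p \<le> length xs" | (head) "length xs \<le> p" "p \<le> length xs + length ys"
      by linarith
    then show "g (xs @ (sg a u + sg b v) # ys) = sm a (g (xs @ u # ys)) + sm b (g (xs @ v # ys))"
    proof cases
      case short
      then show ?thesis by (simp add: g_def)
    next
      case tail
      define us ws where "us = take (Suc p) xs" and "ws = drop (Suc p) xs"
      have xs: "xs = us @ ws" and us: "length us = Suc p"
        using tail by (simp_all add: us_def ws_def)
      show ?thesis
        by (simp add: xs g_head[OF us] mlinD[OF \<sigma>m] sgnp_lin)
    next
      case head
      define us ws where "us = take (p - length xs) ys" and "ws = drop (p - length xs) ys"
      have ys: "ys = us @ ws" and us: "length us = p - length xs"
        using head by (simp_all add: us_def ws_def)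
      have g_eq: "g (xs @ w # ys) = sgnp q (\<sigma> (\<lambda>zs. f (xs @ w # us @ zs)) ws)" for w
        using g_head[of "xs @ w # us" ws] us head by (simp add: ys)
      show ?thesis
        unfolding g_eq mlinD[OF fm] \<sigma>lin sgnp_lin ..
    qed
  qed
  moreover have "g zs = 0" if "length zs \<noteq> k - 1" for zs
  proof (cases "Suc p \<le> length zs")
    case True
    have "\<sigma> v (drop (Suc p) zs) = 0" for v
      using \<sigma>V[of v] that True p
      by (auto simp: V_def L_cochains_iff j_def split: if_splits)
    then show ?thesis by (simp add: g_def)
  qed (simp add: g_def)
  ultimately have gL: "g \<in> L_cochains sg sm (k - 1)"
    by (simp add: L_cochains_iff)
  have g_alt: "alt p g"
    unfolding alt_def
  proof (intro allI impI)
    fix xs :: "'g list" and x ys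
    assume le: "length xs + 2 \<le> p"
    show "g (xs @ x # x # ys) = 0"
    proof (cases "Suc p \<le> length xs + 2 + length ys")
      case True
      define us ws where "us = take (p - Suc (length xs)) ys" and "ws = drop (p - Suc (length xs)) ys"
      have ys: "ys = us @ ws" and us: "length us = p - Suc (length xs)"
        using le True by (simp_all add: us_def ws_def)
      have "g (xs @ x # x # ys) = sgnp q (\<sigma> (\<lambda>zs. f (xs @ x # x # us @ zs)) ws)"
        using g_head[of "xs @ x # x # us" ws] us le by (simp add: ys)
      then show ?thesis
        using altD[OF f(2) le] by (simp add: \<sigma>0)
    next
      case False
      then show ?thesis by (simp add: g_def)
    qed
  qed
  have "alt (Suc p) (\<lambda>zs. f zs - cobd g zs)"
    unfolding alt_def
  proof (intro allI impI)
    fix xs :: "'g list" and x ys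
    assume le: "length xs + 2 \<le> Suc p"
    show "f (xs @ x # x # ys) - cobd g (xs @ x # x # ys) = 0"
    \<comment> \<open>Only the pair in positions \<open>p\<close> and \<open>p + 1\<close> is new;
      on earlier pairs \<open>f\<close> and \<open>cobd g\<close> vanish separately.\<close>
    proof (cases "length xs = q")
      case False
      then have le': "length xs + 2 \<le> p" using le q by simp
      show ?thesis
        using altD[OF f(2) le'] altD[OF alt_cobd[OF \<open>mlin g\<close> g_alt] le'] by simp
    next
      case True
      define v where "v = (\<lambda>ws. f (xs @ x # x # ws))"
      have "cobd v ws = 0" for ws
      proof -
        have "0 = cobd f (xs @ x # x # ws)"
          using altD[OF df le] by simp
        also have "\<dots> = sgnp q (cobd v ws)"
          using cobd_repeated[OF fm, of xs x ws] f(2) True by (simp add: q v_def)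
        finally have "sgnp q (sgnp q (cobd v ws)) = sgnp q 0" by simp
        then show ?thesis unfolding sgnp_simps .
      qed
      moreover have "v \<in> L_cochains sg sm j"
        using mlin_append[OF fm, of "xs @ [x, x]"] f0 True p q
        by (auto simp: L_cochains_iff v_def j_def)
      ultimately have "v \<in> BL j"
        using HL by (auto simp: cohom_zero_def ZL_iff j_def)
      then have dv: "cobd (\<sigma> v) = v"
        using \<sigma>d by (auto simp: BV)
      have "g (xs @ x # x # ws) = sgnp q (\<sigma> v ws)" for ws
        using g_head[of "xs @ [x, x]" ws] True q by (simp add: v_def)
      then have "cobd g (xs @ x # x # ys) = sgnp q (cobd (\<lambda>ws. sgnp q (\<sigma> v ws)) ys)"
        using cobd_repeated[OF \<open>mlin g\<close>, of xs x ys] g_alt True by (simp add: q)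
      also have "\<dots> = cobd (\<sigma> v) ys"
        by (simp add: sgnp_def cobd_minus)
      finally show ?thesis by (simp add: dv) (simp add: v_def)
    qed
  qed
  with gL show ?thesis by blast
qed

text \<open>Climbs the filtration by \<open>alt_step\<close>. Allowing an alternating differential
  instead of a zero one covers both cocycles, for surjectivity, and primitives of alternating
  cocycles, for injectivity.\<close>

lemma alternating_representative:
  assumes HL: "\<And>j. j + 2 \<le> k \<Longrightarrow> HL_zero j"
    and f: "f \<in> L_cochains sg sm k" and df: "alt k (cobd f)"
  shows "\<exists>b \<in> BL k. (\<lambda>zs. f zs - b zs) \<in> CE_cochains sg sm k"
proof -
  have "\<exists>b \<in> BL k. alt p (\<lambda>zs. f zs - b zs)" if "p \<le> k" for p
    using that
  proof (induction p)
    case 0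
    show ?case using zero_in_BL[of k] by (auto simp: alt_def)
  next
    case (Suc p)
    \<comment> \<open>Alternation in one argument is vacuous, so \<open>alt_step\<close> starts at
      \<open>p = 1\<close> and the degrees \<open>k - p - 1\<close> that occur are at most
      \<open>k - 2\<close>.\<close>
    show ?case
    proof (cases "p = 0")
      case True
      then show ?thesis using zero_in_BL[of k] by (auto simp: alt_def)
    next
      case False
      from Suc obtain b where b: "b \<in> BL k" "alt p (\<lambda>zs. f zs - b zs)" by auto
      have bZ: "b \<in> L_cochains sg sm k" "\<And>zs. cobd b zs = 0"
        using BL_subset_ZL[OF b(1)] by (simp_all add: ZL_iff)
      have d: "cobd (\<lambda>zs. f zs - b zs) = cobd f"
        by (simp add: fun_eq_iff cobd_diff bZ)
      obtain g where g: "g \<in> L_cochains sg sm (k - 1)"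
        "alt (Suc p) (\<lambda>zs. f zs - b zs - cobd g zs)"
        using alt_step[OF L_cochains_diff[OF f bZ(1)] b(2), unfolded d]
          False Suc.prems HL[of "k - Suc p"] alt_mono[OF df Suc.prems] by auto
      have "cobd g \<in> BL k"
        using g(1) Suc.prems BL_Suc[of "k - 1"] by simp
      then have "(\<lambda>zs. b zs + cobd g zs) \<in> BL k"
        by (rule BL_add[OF b(1)])
      with g(2) show ?thesis by (auto simp: diff_diff_eq)
    qed
  qed
  then obtain b where "b \<in> BL k" "alt k (\<lambda>zs. f zs - b zs)" by blast
  moreover have "b \<in> L_cochains sg sm k"
    using BL_subset_ZL[OF \<open>b \<in> BL k\<close>] by (simp add: ZL_iff)
  ultimately show ?thesis
    using L_cochains_diff[OF f] CE_cochains_iff by blast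
qed

section \<open>Vanishing and comparison of cohomology\<close>

lemma HL_zero_if_HCE_zero:
  assumes "\<forall>k \<le> n. HCE_zero k" "k \<le> n"
  shows "HL_zero k"
  using assms(2)
\<comment> \<open>Vanishing in lower degrees makes a Leibniz cocycle cohomologous to an alternating
  one, which is a coboundary by the hypothesis on \<open>HCE_zero\<close>.\<close>
proof (induction k rule: less_induct)
  case (less k)
  show ?case
    unfolding cohom_zero_def
  proof
    fix f
    assume f: "f \<in> ZL k"
    then have "f \<in> L_cochains sg sm k" "alt k (cobd f)"
      by (simp_all add: ZL_iff alt_def)
    moreover have "HL_zero j" if "j + 2 \<le> k" for j
      using less that by simp
    ultimately obtain b where b: "b \<in> BL k" "(\<lambda>zs. f zs - b zs) \<in> CE_cochains sg sm k"
      using alternating_representative by blast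
    have "(\<lambda>zs. f zs - b zs) \<in> ZCE k"
      using b(2) f BL_subset_ZL[OF b(1)] by (simp add: ZCE_iff ZL_iff cobd_diff)
    then have "(\<lambda>zs. f zs - b zs) \<in> BL k"
      using assms(1) less.prems BCE_subset_BL by (auto simp: cohom_zero_def)
    from BL_add[OF this b(1)] show "f \<in> BL k" by simp
  qed
qed

text \<open>The inclusion of complexes induces the isomorphism. It is injective because a Leibniz
  primitive of an alternating cocycle can be made alternating, and surjective because a Leibniz
  cocycle can.\<close>

lemma CE_L_iso_if_HL_zero:
  assumes HL: "\<And>j. j + 2 \<le> k \<Longrightarrow> HL_zero j"
  shows "CE_L_iso sg br sm act k"
  unfolding CE_L_iso_def quot_iso_def
proof (intro exI[of _ "\<lambda>z. z"] conjI ballI allI impI)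
  show "z \<in> ZL k" if "z \<in> ZCE k" for z
    using that by (rule ZCE_subset_ZL)
next
  fix z
  assume z: "z \<in> ZCE k"
  show "z \<in> BL k \<longleftrightarrow> z \<in> BCE k"
  proof
    assume zB: "z \<in> BL k"
    show "z \<in> BCE k"
    proof (cases k)
      case 0
      with zB show ?thesis by (simp add: BL_0 BCE_0)
    next
      case (Suc m)
      with zB obtain h where h: "h \<in> L_cochains sg sm m" "z = cobd h"
        by (auto simp: BL_Suc)
      have "alt m (cobd h)"
        using z alt_mono[of k z m] by (simp add: h Suc ZCE_iff CE_cochains_iff)
      moreover have "HL_zero j" if "j + 2 \<le> m" for j
        using HL that Suc by simp
      ultimately obtain b where b: "b \<in> BL m" "(\<lambda>zs. h zs - b zs) \<in> CE_cochains sg sm m"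
        using alternating_representative[OF _ h(1)] by blast
      have "z = cobd (\<lambda>zs. h zs - b zs)"
        using BL_subset_ZL[OF b(1)] by (simp add: h fun_eq_iff cobd_diff ZL_iff)
      with b(2) show ?thesis by (simp add: Suc BCE_Suc)
    qed
  qed (rule BCE_subset_BL)
next
  fix w :: "'g list \<Rightarrow> 'm"
  assume w: "w \<in> ZL k"
  then have "w \<in> L_cochains sg sm k" "alt k (cobd w)"
    by (simp_all add: ZL_iff alt_def)
  then obtain b where b: "b \<in> BL k" "(\<lambda>zs. w zs - b zs) \<in> CE_cochains sg sm k"
    using alternating_representative[OF HL] by blast
  have "(\<lambda>zs. w zs - b zs) \<in> ZCE k"
    using b(2) w BL_subset_ZL[OF b(1)] by (simp add: ZCE_iff ZL_iff cobd_diff)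
  then show "\<exists>z \<in> ZCE k. (\<lambda>y. w y - z y) \<in> BL k"
    using b(1) by (intro bexI[of _ "\<lambda>zs. w zs - b zs"]) simp_all
qed simp

end

theorem theorem2p6:
  fixes sg :: "'k::field \<Rightarrow> 'g::ab_group_add \<Rightarrow> 'g"
    and br :: "'g \<Rightarrow> 'g \<Rightarrow> 'g"
    and sm :: "'k \<Rightarrow> 'm::ab_group_add \<Rightarrow> 'm"
    and act :: "'g \<Rightarrow> 'm \<Rightarrow> 'm"
    and n :: nat
  assumes "lie_algebra sg br"
    and "lie_module sg br sm act"
  shows "((\<forall>k\<le>n. cohom_zero (CE_cochains sg sm) (CE_d br act) k) \<longrightarrow>
            (\<forall>k\<le>n. cohom_zero (L_cochains sg sm) (L_d br act) k) \<and>
            CE_L_iso sg br sm act (n + 1) \<and> CE_L_iso sg br sm act (n + 2))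
       \<and> ((\<forall>k. cohom_zero (CE_cochains sg sm) (CE_d br act) k) \<longrightarrow>
            (\<forall>k. cohom_zero (L_cochains sg sm) (L_d br act) k))"
proof -
  interpret lie_rep sg br sm act
    using assms by unfold_locales
  show ?thesis
  proof (intro conjI impI allI)
    assume H: "\<forall>k\<le>n. HCE_zero k"
    show "HL_zero k" if "k \<le> n" for k
      using HL_zero_if_HCE_zero[OF H that] .
    \<comment> \<open>The two isomorphisms use vanishing up to degree \<open>n - 1\<close> and up to
      degree \<open>n\<close>, respectively.\<close>
    then show "CE_L_iso sg br sm act (n + 1)" "CE_L_iso sg br sm act (n + 2)"
      by (simp_all add: CE_L_iso_if_HL_zero)
  next
    fix k
    assume "\<forall>k. HCE_zero k"
    then show "HL_zero k"
      using HL_zero_if_HCE_zero[of k k] by simp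
  qed
qed

end
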